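(* Let $u\in W^{1,p}_D(\Omega)$ be a minimizer of $I$ and let $z\in L^{p'}(\Omega;\mathbb{R}^d)$ be a maximizer of $D$, with $I(u)=D(z)$, where $I$ and $D$ are the primal and dual functionals described in the context. For $v\in W^{1,p}_D(\Omega)$ and $y\in L^{p'}(\Omega;\mathbb{R}^d)$ set $$\rho_I^2(v,u):=I(v)-I(u),\qquad \rho_{-D}^2(y,z):=D(z)-D(y),\qquad \eta^2(v,y):=I(v)-D(y).$$ Then the following statements apply: (i) For every $v\in W^{1,p}_D(\Omega)$ and $y\in L^{p'}(\Omega;\mathbb{R}^d)$, $$\rho^2_I(v,u)+\rho^2_{-D}(y,z)=\eta^2(v,y).$$ (ii) For every $v\in W^{1,p}_D(\Omega)$ and $y\in W^{p'}_N(\mathrm{div};\Omega)$, $$\eta^2(v,y)=\int_{\Omega}\big(\phi(\nabla v)-\nabla v\cdot y+\phi^*(y)\big)\,\mathrm{d}x+\int_{\Omega}\big(\psi(\cdot,v)-v\,\mathrm{div}\,y+\psi^*(\cdot,\mathrm{div}\,y)\big)\,\mathrm{d}x.$$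
   Context: Let $\Omega\subseteq\mathbb{R}^d$, $d\in\mathbb{N}$, be a bounded polyhedral Lipschitz domain whose boundary is the disjoint union of a closed Dirichlet part $\Gamma_D$ and an open Neumann part $\Gamma_N$. Let $p\in(1,\infty)$ and $p'=p/(p-1)$. Let $W^{1,p}_D(\Omega)$ be the space of $v\in W^{1,p}(\Omega)$ with zero trace on $\Gamma_D$, and let $W^{p'}_N(\mathrm{div};\Omega)$ be the space of $y\in L^{p'}(\Omega;\mathbb{R}^d)$ with $\mathrm{div}\,y\in L^{p'}(\Omega)$ and vanishing normal trace on $\Gamma_N$; in particular, $(\mathrm{div}\,y,v)_\Omega=-(y,\nabla v)_\Omega$ for all $y\in W^{p'}_N(\mathrm{div};\Omega)$ and $v\in W^{1,p}_D(\Omega)$, where $(\cdot,\cdot)_\Omega$ denotes the integral over $\Omega$ of the (Euclidean) product. Let $\phi:\mathbb{R}^d\to\mathbb{R}\cup\{+\infty\}$ be proper, convex and lower semi-continuous, and let $\psi:\Omega\times\mathbb{R}\to\mathbb{R}\cup\{+\infty\}$ be measurable such that $\psi(x,\cdot)$ is proper, convex and lower semi-continuous for a.e. $x\in\Omega$. Let $\phi^*$ be the Fenchel conjugate of $\phi$ and $\psi^*$ the Fenchel conjugate of $\psi$ with respect to its second argument. Primal functional: $I:W^{1,p}_D(\Omega)\to\mathbb{R}\cup\{+\infty\}$, $I(v):=\int_\Omega\phi(\nabla v)\,\mathrm{d}x+\int_\Omega\psi(\cdot,v)\,\mathrm{d}x$. Dual functional: $D:L^{p'}(\Omega;\mathbb{R}^d)\to\mathbb{R}\cup\{-\infty\}$,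 $D(y):=-\int_\Omega\phi^*(y)\,\mathrm{d}x-F^*(\mathrm{Div}\,y)$, where $\mathrm{Div}\,y\in(W^{1,p}_D(\Omega))^*$ is given by $\langle\mathrm{Div}\,y,v\rangle=-(y,\nabla v)_\Omega$ and $F^*$ is the Fenchel conjugate of $F(v):=\int_\Omega\psi(\cdot,v)\,\mathrm{d}x$. For $y\in W^{p'}_N(\mathrm{div};\Omega)$ one has the representation $$D(y)=-\int_\Omega\phi^*(y)\,\mathrm{d}x-\int_\Omega\psi^*(\cdot,\mathrm{div}\,y)\,\mathrm{d}x,$$ which is part of the setting. Standing assumptions: $I$ and $-D$ are proper; all integrals defining $I$ and $D$ are well-defined with values in $\mathbb{R}\cup\{+\infty\}$ resp. $\mathbb{R}\cup\{-\infty\}$; weak duality $\inf I\ge\sup D$ holds; $I$ admits at least one minimizer $u$, $D$ admits at least one maximizer $z$, and strong duality $I(u)=D(z)$ holds. *)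

theory Defs
  imports "HOL-Analysis.Analysis"
begin

text \<open>
  Elements of function spaces over \<open>\<Omega>\<close> are represented by total functions on \<open>real ^ 'd\<close>; their
  values outside \<open>\<Omega>\<close> and on null sets are irrelevant. All integrals over \<open>\<Omega>\<close> are taken with respect
  to \<open>lebesgue_on \<Omega>\<close>.
\<close>

section \<open>Polyhedral Lipschitz domains\<close>

text \<open>
  Near every boundary point the domain is, in a suitable direction \<open>e\<close>, the strict epigraph of a
  Lipschitz function \<open>g\<close> of the coordinates orthogonal to \<open>e\<close>.
\<close>

definition lipschitz_boundary :: "(real ^ 'd) set \<Rightarrow> bool" where
  "lipschitz_boundary \<Omega> \<longleftrightarrow>
     (\<forall>x\<in>frontier \<Omega>. \<exists>e g L r. norm e = 1 \<and> 0 < r \<and>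
        L-lipschitz_on {w. w \<bullet> e = 0} (g :: real ^ 'd \<Rightarrow> real) \<and>
        \<Omega> \<inter> ball x r = {y \<in> ball x r. g (y - (y \<bullet> e) *\<^sub>R e) < y \<bullet> e})"

definition polyhedral_lipschitz_domain :: "(real ^ 'd) set \<Rightarrow> bool" where
  "polyhedral_lipschitz_domain \<Omega> \<longleftrightarrow>
     \<Omega> \<noteq> {} \<and> open \<Omega> \<and> connected \<Omega> \<and> bounded \<Omega> \<and> lipschitz_boundary \<Omega> \<and>
     (\<exists>\<P>. finite \<P> \<and> (\<forall>P\<in>\<P>. polytope P) \<and> closure \<Omega> = \<Union>\<P>)"

section \<open>Surface measure\<close>

text \<open>
  The \<open>s\<close>-dimensional Hausdorff outer measure, with the normalisation for which it is the
  surface area of smooth \<open>s\<close>-dimensional surfaces (and the counting measure for \<open>s = 0\<close>).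
  Covering sets are required to be bounded because \<^const>\<open>diameter\<close> is real-valued; the case
  distinction is needed for \<open>s = 0\<close> only, since \<open>0 ^ 0 = 1\<close>.
\<close>

definition hausdorff_premeasure :: "nat \<Rightarrow> real \<Rightarrow> 'a::metric_space set \<Rightarrow> ennreal" where
  "hausdorff_premeasure s \<delta> A =
     (INF U \<in> {U :: nat \<Rightarrow> 'a set. A \<subseteq> (\<Union>i. U i) \<and> (\<forall>i. bounded (U i) \<and> diameter (U i) \<le> \<delta>)}.
        \<Sum>i. if U i = {} then 0 else ennreal (unit_ball_vol (real s) * (diameter (U i) / 2) ^ s))"

definition hausdorff_outer :: "nat \<Rightarrow> 'a::metric_space set \<Rightarrow> ennreal" where
  "hausdorff_outer s A = (SUP \<delta>\<in>{0<..}. hausdorff_premeasure s \<delta> A)"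

text \<open>
  The outer measure is a metric outer measure, so that it is countably additive on the Borel sets.
\<close>

definition hausdorff_measure :: "nat \<Rightarrow> 'a::metric_space measure" where
  "hausdorff_measure s = measure_of UNIV (sets borel) (hausdorff_outer s)"

definition surface_measure :: "(real ^ 'd) set \<Rightarrow> (real ^ 'd) measure" where
  "surface_measure \<Omega> = restrict_space (hausdorff_measure (CARD('d) - 1)) (frontier \<Omega>)"

section \<open>Smooth functions, weak gradient and weak divergence\<close>

definition grad :: "(real ^ 'd \<Rightarrow> real) \<Rightarrow> real ^ 'd \<Rightarrow> real ^ 'd" where
  "grad f x = (\<chi> i. frechet_derivative f (at x) (axis i 1))"

primrec C_k :: "nat \<Rightarrow> (real ^ 'd \<Rightarrow> real) \<Rightarrow> bool" where
  "C_k 0 f \<longleftrightarrow> continuous_on UNIV f"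
| "C_k (Suc k) f \<longleftrightarrow> (\<forall>x. f differentiable (at x)) \<and> (\<forall>i. C_k k (\<lambda>x. grad f x $ i))"

definition smooth :: "(real ^ 'd \<Rightarrow> real) \<Rightarrow> bool" where
  "smooth f \<longleftrightarrow> (\<forall>k. C_k k f)"

definition test_function :: "(real ^ 'd) set \<Rightarrow> (real ^ 'd \<Rightarrow> real) \<Rightarrow> bool" where
  "test_function \<Omega> \<theta> \<longleftrightarrow>
     smooth \<theta> \<and> compact (closure {x. \<theta> x \<noteq> 0}) \<and> closure {x. \<theta> x \<noteq> 0} \<subseteq> \<Omega>"

definition locally_integrable :: "(real ^ 'd) set \<Rightarrow> (real ^ 'd \<Rightarrow> 'b::euclidean_space) \<Rightarrow> bool" where
  "locally_integrable \<Omega> f \<longleftrightarrow> (\<forall>K. compact K \<and> K \<subseteq> \<Omega> \<longrightarrow> integrable (lebesgue_on K) f)"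

definition has_weak_grad :: "(real ^ 'd) set \<Rightarrow> (real ^ 'd \<Rightarrow> real) \<Rightarrow> (real ^ 'd \<Rightarrow> real ^ 'd) \<Rightarrow> bool" where
  "has_weak_grad \<Omega> v g \<longleftrightarrow> locally_integrable \<Omega> v \<and> locally_integrable \<Omega> g \<and>
     (\<forall>\<theta> i. test_function \<Omega> \<theta> \<longrightarrow>
        (LINT x|lebesgue_on \<Omega>. v x * grad \<theta> x $ i) = - (LINT x|lebesgue_on \<Omega>. g x $ i * \<theta> x))"

definition has_weak_div :: "(real ^ 'd) set \<Rightarrow> (real ^ 'd \<Rightarrow> real ^ 'd) \<Rightarrow> (real ^ 'd \<Rightarrow> real) \<Rightarrow> bool" where
  "has_weak_div \<Omega> y g \<longleftrightarrow> locally_integrable \<Omega> y \<and> locally_integrable \<Omega> g \<and>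
     (\<forall>\<theta>. test_function \<Omega> \<theta> \<longrightarrow>
        (LINT x|lebesgue_on \<Omega>. y x \<bullet> grad \<theta> x) = - (LINT x|lebesgue_on \<Omega>. g x * \<theta> x))"

text \<open>
  Weak gradients and weak divergences are unique up to null sets; the choice operator selects
  a representative.
\<close>

definition weak_grad :: "(real ^ 'd) set \<Rightarrow> (real ^ 'd \<Rightarrow> real) \<Rightarrow> real ^ 'd \<Rightarrow> real ^ 'd" where
  "weak_grad \<Omega> v = (SOME g. has_weak_grad \<Omega> v g)"

definition weak_div :: "(real ^ 'd) set \<Rightarrow> (real ^ 'd \<Rightarrow> real ^ 'd) \<Rightarrow> real ^ 'd \<Rightarrow> real" where
  "weak_div \<Omega> y = (SOME g. has_weak_div \<Omega> y g)"

section \<open>Function spaces\<close>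

definition Lp :: "(real ^ 'd) set \<Rightarrow> real \<Rightarrow> (real ^ 'd \<Rightarrow> 'b::euclidean_space) set" where
  "Lp \<Omega> p = {f. f \<in> borel_measurable (lebesgue_on \<Omega>) \<and>
                integrable (lebesgue_on \<Omega>) (\<lambda>x. norm (f x) powr p)}"

definition W1p :: "(real ^ 'd) set \<Rightarrow> real \<Rightarrow> (real ^ 'd \<Rightarrow> real) set" where
  "W1p \<Omega> p = {v. v \<in> Lp \<Omega> p \<and> (\<exists>g. has_weak_grad \<Omega> v g) \<and> weak_grad \<Omega> v \<in> Lp \<Omega> p}"

definition W_div :: "(real ^ 'd) set \<Rightarrow> real \<Rightarrow> (real ^ 'd \<Rightarrow> real ^ 'd) set" where
  "W_div \<Omega> q = {y. y \<in> Lp \<Omega> q \<and> (\<exists>g. has_weak_div \<Omega> y g) \<and> weak_div \<Omega> y \<in> Lp \<Omega> q}"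

text \<open>
  The graph of the trace operator from \<open>W1p\<close> to \<open>L\<^sup>p\<close> of the boundary, i.e. of the continuous
  extension of the restriction map on functions that are smooth up to the boundary.
\<close>

definition has_trace :: "(real ^ 'd) set \<Rightarrow> real \<Rightarrow> (real ^ 'd \<Rightarrow> real) \<Rightarrow> (real ^ 'd \<Rightarrow> real) \<Rightarrow> bool" where
  "has_trace \<Omega> p v g \<longleftrightarrow> v \<in> W1p \<Omega> p \<and>
     g \<in> borel_measurable (surface_measure \<Omega>) \<and>
     integrable (surface_measure \<Omega>) (\<lambda>x. \<bar>g x\<bar> powr p) \<and>
     (\<exists>w. (\<forall>k::nat. smooth (w k)) \<and>
        (\<lambda>k. \<integral>\<^sup>+x. ennreal (\<bar>w k x - v x\<bar> powr p) \<partial>lebesgue_on \<Omega>) \<longlonglongrightarrow> 0 \<and>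
        (\<lambda>k. \<integral>\<^sup>+x. ennreal (norm (grad (w k) x - weak_grad \<Omega> v x) powr p) \<partial>lebesgue_on \<Omega>) \<longlonglongrightarrow> 0 \<and>
        (\<lambda>k. \<integral>\<^sup>+x. ennreal (\<bar>w k x - g x\<bar> powr p) \<partial>surface_measure \<Omega>) \<longlonglongrightarrow> 0)"

definition zero_trace_on :: "(real ^ 'd) set \<Rightarrow> (real ^ 'd) set \<Rightarrow> real \<Rightarrow> (real ^ 'd \<Rightarrow> real) \<Rightarrow> bool" where
  "zero_trace_on \<Omega> \<Gamma> p v \<longleftrightarrow>
     (\<exists>g. has_trace \<Omega> p v g \<and> (AE x in surface_measure \<Omega>. x \<in> \<Gamma> \<longrightarrow> g x = 0))"

definition W1p_D :: "(real ^ 'd) set \<Rightarrow> (real ^ 'd) set \<Rightarrow> real \<Rightarrow> (real ^ 'd \<Rightarrow> real) set" where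
  "W1p_D \<Omega> \<Gamma>\<^sub>D p = {v \<in> W1p \<Omega> p. zero_trace_on \<Omega> \<Gamma>\<^sub>D p v}"

text \<open>
  The normal trace of \<open>y\<close> is a functional on the boundary values of Sobolev functions, given by
  Green's formula. It vanishes on a part \<open>\<Gamma>\<close> of the boundary if it annihilates all boundary values
  that are zero on the rest of the boundary.
\<close>

definition normal_trace :: "(real ^ 'd) set \<Rightarrow> (real ^ 'd \<Rightarrow> real ^ 'd) \<Rightarrow> (real ^ 'd \<Rightarrow> real) \<Rightarrow> real" where
  "normal_trace \<Omega> y v =
     (LINT x|lebesgue_on \<Omega>. y x \<bullet> weak_grad \<Omega> v x) + (LINT x|lebesgue_on \<Omega>. weak_div \<Omega> y x * v x)"

definition W_N_div :: "(real ^ 'd) set \<Rightarrow> (real ^ 'd) set \<Rightarrow> real \<Rightarrow> (real ^ 'd \<Rightarrow> real ^ 'd) set" where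
  "W_N_div \<Omega> \<Gamma>\<^sub>N q = {y \<in> W_div \<Omega> q.
     \<forall>v \<in> W1p \<Omega> (q / (q - 1)).
       zero_trace_on \<Omega> (frontier \<Omega> - \<Gamma>\<^sub>N) (q / (q - 1)) v \<longrightarrow> normal_trace \<Omega> y v = 0}"

section \<open>Extended-real-valued convex analysis\<close>

definition proper_on :: "'a set \<Rightarrow> ('a \<Rightarrow> ereal) \<Rightarrow> bool" where
  "proper_on S f \<longleftrightarrow> (\<forall>x\<in>S. f x \<noteq> -\<infinity>) \<and> (\<exists>x\<in>S. f x \<noteq> \<infinity>)"

definition convex_ereal :: "('a::real_vector \<Rightarrow> ereal) \<Rightarrow> bool" where
  "convex_ereal f \<longleftrightarrow> (\<forall>x y t. 0 < t \<and> t < 1 \<longrightarrow>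
     f ((1 - t) *\<^sub>R x + t *\<^sub>R y) \<le> ereal (1 - t) * f x + ereal t * f y)"

definition lsc :: "('a::topological_space \<Rightarrow> ereal) \<Rightarrow> bool" where
  "lsc f \<longleftrightarrow> (\<forall>x. f x \<le> Liminf (at x) f)"

definition fenchel_conj :: "('a::real_inner \<Rightarrow> ereal) \<Rightarrow> 'a \<Rightarrow> ereal" where
  "fenchel_conj f y = (SUP x. ereal (x \<bullet> y) - f x)"

text \<open>Conjugate of a functional on a function space \<open>V\<close>, evaluated at a linear functional \<open>\<xi>\<close>.\<close>

definition fenchel_conj_on :: "'v set \<Rightarrow> ('v \<Rightarrow> ereal) \<Rightarrow> ('v \<Rightarrow> real) \<Rightarrow> ereal" where
  "fenchel_conj_on V F \<xi> = (SUP v\<in>V. ereal (\<xi> v) - F v)"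

text \<open>
  The integral of an extended-real-valued function, meaningful if \<open>integral_well_defined\<close> holds;
  it then takes values in the reals extended by \<open>\<infinity>\<close>. Note that \<^const>\<open>e2ennreal\<close> maps
  negative numbers to \<open>0\<close>.
\<close>

definition ereal_integral :: "'a measure \<Rightarrow> ('a \<Rightarrow> ereal) \<Rightarrow> ereal" where
  "ereal_integral M f =
     enn2ereal (\<integral>\<^sup>+x. e2ennreal (f x) \<partial>M) - enn2ereal (\<integral>\<^sup>+x. e2ennreal (- f x) \<partial>M)"

definition integral_well_defined :: "'a measure \<Rightarrow> ('a \<Rightarrow> ereal) \<Rightarrow> bool" where
  "integral_well_defined M f \<longleftrightarrow> f \<in> borel_measurable M \<and> (\<integral>\<^sup>+x. e2ennreal (- f x) \<partial>M) < \<infinity>"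

section \<open>Primal and dual functionals\<close>

definition F_functional :: "(real ^ 'd) set \<Rightarrow> (real ^ 'd \<Rightarrow> real \<Rightarrow> ereal) \<Rightarrow> (real ^ 'd \<Rightarrow> real) \<Rightarrow> ereal" where
  "F_functional \<Omega> \<psi> v = ereal_integral (lebesgue_on \<Omega>) (\<lambda>x. \<psi> x (v x))"

definition primal_functional ::
  "(real ^ 'd) set \<Rightarrow> (real ^ 'd \<Rightarrow> ereal) \<Rightarrow> (real ^ 'd \<Rightarrow> real \<Rightarrow> ereal) \<Rightarrow> (real ^ 'd \<Rightarrow> real) \<Rightarrow> ereal" where
  "primal_functional \<Omega> \<phi> \<psi> v =
     ereal_integral (lebesgue_on \<Omega>) (\<lambda>x. \<phi> (weak_grad \<Omega> v x)) + F_functional \<Omega> \<psi> v"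

definition Div :: "(real ^ 'd) set \<Rightarrow> (real ^ 'd \<Rightarrow> real ^ 'd) \<Rightarrow> (real ^ 'd \<Rightarrow> real) \<Rightarrow> real" where
  "Div \<Omega> y v = - (LINT x|lebesgue_on \<Omega>. y x \<bullet> weak_grad \<Omega> v x)"

definition dual_functional ::
  "(real ^ 'd) set \<Rightarrow> (real ^ 'd) set \<Rightarrow> real \<Rightarrow> (real ^ 'd \<Rightarrow> ereal) \<Rightarrow> (real ^ 'd \<Rightarrow> real \<Rightarrow> ereal) \<Rightarrow>
   (real ^ 'd \<Rightarrow> real ^ 'd) \<Rightarrow> ereal" where
  "dual_functional \<Omega> \<Gamma>\<^sub>D p \<phi> \<psi> y =
     - ereal_integral (lebesgue_on \<Omega>) (\<lambda>x. fenchel_conj \<phi> (y x))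
     - fenchel_conj_on (W1p_D \<Omega> \<Gamma>\<^sub>D p) (F_functional \<Omega> \<psi>) (Div \<Omega> y)"

text \<open>
  The error measures \<open>\<rho>\<^sub>I\<^sup>2\<close>, \<open>\<rho>\<^sub>-\<^sub>D\<^sup>2\<close> and the primal-dual gap estimator \<open>\<eta>\<^sup>2\<close>; the squares are
  part of the names.
\<close>

definition rho2_primal ::
  "(real ^ 'd) set \<Rightarrow> (real ^ 'd \<Rightarrow> ereal) \<Rightarrow> (real ^ 'd \<Rightarrow> real \<Rightarrow> ereal) \<Rightarrow>
   (real ^ 'd \<Rightarrow> real) \<Rightarrow> (real ^ 'd \<Rightarrow> real) \<Rightarrow> ereal" where
  "rho2_primal \<Omega> \<phi> \<psi> v u = primal_functional \<Omega> \<phi> \<psi> v - primal_functional \<Omega> \<phi> \<psi> u"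

definition rho2_dual ::
  "(real ^ 'd) set \<Rightarrow> (real ^ 'd) set \<Rightarrow> real \<Rightarrow> (real ^ 'd \<Rightarrow> ereal) \<Rightarrow> (real ^ 'd \<Rightarrow> real \<Rightarrow> ereal) \<Rightarrow>
   (real ^ 'd \<Rightarrow> real ^ 'd) \<Rightarrow> (real ^ 'd \<Rightarrow> real ^ 'd) \<Rightarrow> ereal" where
  "rho2_dual \<Omega> \<Gamma>\<^sub>D p \<phi> \<psi> y z = dual_functional \<Omega> \<Gamma>\<^sub>D p \<phi> \<psi> z - dual_functional \<Omega> \<Gamma>\<^sub>D p \<phi> \<psi> y"

definition eta2 ::
  "(real ^ 'd) set \<Rightarrow> (real ^ 'd) set \<Rightarrow> real \<Rightarrow> (real ^ 'd \<Rightarrow> ereal) \<Rightarrow> (real ^ 'd \<Rightarrow> real \<Rightarrow> ereal) \<Rightarrow>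
   (real ^ 'd \<Rightarrow> real) \<Rightarrow> (real ^ 'd \<Rightarrow> real ^ 'd) \<Rightarrow> ereal" where
  "eta2 \<Omega> \<Gamma>\<^sub>D p \<phi> \<psi> v y = primal_functional \<Omega> \<phi> \<psi> v - dual_functional \<Omega> \<Gamma>\<^sub>D p \<phi> \<psi> y"

end

theory Submission
  imports Defs
begin

text \<open>
  In (i) the common finite value \<open>I(u) = D(z)\<close> cancels. For (ii), \<open>v\<close> has zero trace on \<open>\<Gamma>\<^sub>D\<close> and the
  normal trace of \<open>y\<close> vanishes on \<open>\<Gamma>\<^sub>N\<close>, so that the integrals of \<open>\<nabla>v \<bullet> y\<close> and \<open>v div y\<close> add up to
  \<open>0\<close> and may be subtracted from \<open>I(v) - D(y)\<close>. They are finite by Hoelder's inequality, and the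
  four remaining integrals are not \<open>-\<infinity>\<close>, so that each group of terms can be merged into one integral.
\<close>

text \<open>Positive and negative parts satisfy (a + b)^+ - (a + b)^- = a^+ - a^- + b^+ - b^-.
  Moving every subtracted term to the other side gives an identity in \<open>ennreal\<close> that
  can be integrated even where parts are infinite.\<close>

lemma e2ennreal_add_parts:
  fixes a b :: ereal
  assumes "a \<noteq> -\<infinity>" "b \<noteq> -\<infinity>"
  shows "e2ennreal (a + b) + (e2ennreal (- a) + e2ennreal (- b)) =
         e2ennreal (- (a + b)) + (e2ennreal a + e2ennreal b)"
proof (cases "a = \<infinity> \<or> b = \<infinity>")
  case True
  then show ?thesis
    using assms by (cases a; cases b) auto
next
  case False
  then obtain r s where rs: "a = ereal r" "b = ereal s"
    using assms by (cases a; cases b) auto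
  \<comment> \<open>\<open>ennreal\<close> truncates negative reals to 0, so the parts are written
    as \<open>max 0\<close> before passing to \<open>ennreal\<close>.\<close>
  have "max 0 (r + s) + (max 0 (- r) + max 0 (- s)) = max 0 (- (r + s)) + (max 0 r + max 0 s)"
    by (auto simp: max_def)
  then have "ennreal (max 0 (r + s) + (max 0 (- r) + max 0 (- s))) =
      ennreal (max 0 (- (r + s)) + (max 0 r + max 0 s))"
    by simp
  then show ?thesis
    unfolding rs by (simp add: ennreal_plus ennreal_max_0)
qed

text \<open>Subadditivity of the negative part: it bounds the negative part of a sum, so that
  well-definedness of integrals passes to sums.\<close>

lemma e2ennreal_uminus_add_le:
  fixes a b :: ereal
  assumes "a \<noteq> -\<infinity>" "b \<noteq> -\<infinity>"
  shows "e2ennreal (- (a + b)) \<le> e2ennreal (- a) + e2ennreal (- b)"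
proof (cases "a = \<infinity> \<or> b = \<infinity>")
  case True
  then show ?thesis
    using assms by (cases a; cases b) auto
next
  case False
  then obtain r s where rs: "a = ereal r" "b = ereal s"
    using assms by (cases a; cases b) auto
  have "ennreal (max 0 (- (r + s))) \<le> ennreal (max 0 (- r) + max 0 (- s))"
    by (intro ennreal_leI) (auto simp: max_def)
  then show ?thesis
    unfolding rs by (simp add: ennreal_plus ennreal_max_0)
qed

text \<open>Turns the subtraction-free identity back into differences. The finite negative parts
  become reals and may be moved across the equation, while the positive parts may be
  infinite.\<close>

lemma enn2ereal_diff_eqI:
  fixes hp hn fp fn gp gn :: ennreal
  assumes eq: "hp + (fn + gn) = hn + (fp + gp)"
    and fin: "fn < \<infinity>" "gn < \<infinity>" "hn < \<infinity>"
  shows "enn2ereal hp - enn2ereal hn =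
    (enn2ereal fp - enn2ereal fn) + (enn2ereal gp - enn2ereal gn)"
proof -
  obtain a b c where abc: "enn2ereal fn = ereal a" "enn2ereal gn = ereal b" "enn2ereal hn = ereal c"
    using fin by (cases fn; cases gn; cases hn) auto
  have "enn2ereal hp + (enn2ereal fn + enn2ereal gn) = enn2ereal hn + (enn2ereal fp + enn2ereal gp)"
    using arg_cong[OF eq, of enn2ereal] by (simp add: plus_ennreal.rep_eq)
  moreover have "enn2ereal hp \<ge> 0" "enn2ereal fp \<ge> 0" "enn2ereal gp \<ge> 0"
    by simp_all
  ultimately show ?thesis
    unfolding abc by (cases "enn2ereal hp"; cases "enn2ereal fp"; cases "enn2ereal gp") auto
qed

text \<open>The negative part has finite integral, hence is finite almost everywhere, and it is
  infinite exactly where \<open>f x\<close> is -\<infinity>.\<close>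

lemma integral_well_defined_AE_not_MInf:
  assumes "integral_well_defined M f"
  shows "AE x in M. f x \<noteq> -\<infinity>"
proof -
  have [measurable]: "f \<in> borel_measurable M"
    and fin: "(\<integral>\<^sup>+x. e2ennreal (- f x) \<partial>M) \<noteq> \<infinity>"
    using assms by (auto simp: integral_well_defined_def)
  have "AE x in M. e2ennreal (- f x) \<noteq> \<infinity>"
    using fin by (intro nn_integral_PInf_AE) auto
  then show ?thesis
    by eventually_elim auto
qed

lemma ereal_integral_not_MInf:
  assumes "integral_well_defined M f"
  shows "ereal_integral M f \<noteq> -\<infinity>"
  using assms unfolding integral_well_defined_def ereal_integral_def
  by (cases "\<integral>\<^sup>+x. e2ennreal (f x) \<partial>M"; cases "\<integral>\<^sup>+x. e2ennreal (- f x) \<partial>M") auto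

text \<open>Additivity when the positive parts may have infinite integral: the nonnegative parts are
  integrated in \<open>ennreal\<close>, and differences are formed only once all negative parts are
  known to have finite integral.\<close>

lemma ereal_integral_add:
  assumes f: "integral_well_defined M f" and g: "integral_well_defined M g"
  shows "integral_well_defined M (\<lambda>x. f x + g x)"
    and "ereal_integral M (\<lambda>x. f x + g x) = ereal_integral M f + ereal_integral M g"
proof -
  have [measurable]: "f \<in> borel_measurable M" "g \<in> borel_measurable M"
    using f g by (auto simp: integral_well_defined_def)
  define fp fn gp gn hp hn where parts:
    "fp = (\<integral>\<^sup>+x. e2ennreal (f x) \<partial>M)" "fn = (\<integral>\<^sup>+x. e2ennreal (- f x) \<partial>M)"
    "gp = (\<integral>\<^sup>+x. e2ennreal (g x) \<partial>M)" "gn = (\<integral>\<^sup>+x. e2ennreal (- g x) \<partial>M)"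
    "hp = (\<integral>\<^sup>+x. e2ennreal (f x + g x) \<partial>M)" "hn = (\<integral>\<^sup>+x. e2ennreal (- (f x + g x)) \<partial>M)"
  have fin: "fn < \<infinity>" "gn < \<infinity>"
    using f g by (auto simp: integral_well_defined_def parts)
  have AE: "AE x in M. f x \<noteq> -\<infinity> \<and> g x \<noteq> -\<infinity>"
    using integral_well_defined_AE_not_MInf[OF f] integral_well_defined_AE_not_MInf[OF g]
    by (rule eventually_conj)
  have "hn \<le> (\<integral>\<^sup>+x. e2ennreal (- f x) + e2ennreal (- g x) \<partial>M)"
    unfolding parts
    by (intro nn_integral_mono_AE eventually_mono[OF AE] e2ennreal_uminus_add_le) auto
  also have "\<dots> = fn + gn"
    unfolding parts by (intro nn_integral_add) auto
  finally have hn: "hn < \<infinity>"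
    using fin by (auto simp: less_top[symmetric] top_unique)
  then show "integral_well_defined M (\<lambda>x. f x + g x)"
    by (simp add: integral_well_defined_def parts)
  have "(\<integral>\<^sup>+x. e2ennreal (f x + g x) + (e2ennreal (- f x) + e2ennreal (- g x)) \<partial>M) =
        (\<integral>\<^sup>+x. e2ennreal (- (f x + g x)) + (e2ennreal (f x) + e2ennreal (g x)) \<partial>M)"
    by (intro nn_integral_cong_AE eventually_mono[OF AE] e2ennreal_add_parts) auto
  then have "hp + (fn + gn) = hn + (fp + gp)"
    unfolding parts by (simp add: nn_integral_add)
  then have "enn2ereal hp - enn2ereal hn =
      (enn2ereal fp - enn2ereal fn) + (enn2ereal gp - enn2ereal gn)"
    using fin hn by (intro enn2ereal_diff_eqI)
  then show "ereal_integral M (\<lambda>x. f x + g x) = ereal_integral M f + ereal_integral M g"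
    by (simp add: ereal_integral_def parts)
qed

lemma ereal_integral_real:
  fixes h :: "'a \<Rightarrow> real"
  assumes h: "integrable M h"
  shows "integral_well_defined M (\<lambda>x. ereal (h x))"
    and "ereal_integral M (\<lambda>x. ereal (h x)) = ereal (\<integral>x. h x \<partial>M)"
proof -
  obtain r s where r: "0 \<le> r" "(\<integral>\<^sup>+x. ennreal (h x) \<partial>M) = ennreal r"
    and s: "0 \<le> s" "(\<integral>\<^sup>+x. ennreal (- h x) \<partial>M) = ennreal s"
    and I: "integral\<^sup>L M h = r - s"
    using integrableE[OF h] by metis
  show "integral_well_defined M (\<lambda>x. ereal (h x))"
    using h s by (auto simp: integral_well_defined_def)
  show "ereal_integral M (\<lambda>x. ereal (h x)) = ereal (\<integral>x. h x \<partial>M)"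
    using r s I by (simp add: ereal_integral_def)
qed

lemma ereal_integral_diff_add:
  fixes h :: "'a \<Rightarrow> real"
  assumes f: "integral_well_defined M f" and h: "integrable M h"
    and g: "integral_well_defined M g"
  shows "ereal_integral M (\<lambda>x. f x - ereal (h x) + g x) =
         ereal_integral M f - ereal (\<integral>x. h x \<partial>M) + ereal_integral M g"
proof -
  have h': "integrable M (\<lambda>x. - h x)"
    using h by simp
  \<comment> \<open>Subtracting \<open>h\<close> is adding the integrable function
    \<open>- h\<close>, so additivity applies twice.\<close>
  have eq: "f x - ereal (h x) + g x = (f x + ereal (- h x)) + g x" for x
    by (simp add: minus_ereal_def)
  show ?thesis
    unfolding eq
    using ereal_integral_add(2)[OF ereal_integral_add(1)[OF f ereal_integral_real(1)[OF h']] g]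
      ereal_integral_add(2)[OF f ereal_integral_real(1)[OF h']]
      ereal_integral_real(2)[OF h']
    by (simp add: minus_ereal_def)
qed

text \<open>After Cauchy-Schwarz, Young's inequality with the conjugate exponents provides a
  pointwise integrable majorant.\<close>

lemma integrable_inner_Lp:
  fixes f g :: "real ^ 'd \<Rightarrow> 'b::euclidean_space"
  assumes p: "1 < p" and q: "q = p / (p - 1)"
    and f: "f \<in> Lp \<Omega> p" and g: "g \<in> Lp \<Omega> q"
  shows "integrable (lebesgue_on \<Omega>) (\<lambda>x. f x \<bullet> g x)"
proof (rule Bochner_Integration.integrable_bound)
  show "integrable (lebesgue_on \<Omega>) (\<lambda>x. norm (f x) powr p / p + norm (g x) powr q / q)"
    using f g by (auto simp: Lp_def)
  show "(\<lambda>x. f x \<bullet> g x) \<in> borel_measurable (lebesgue_on \<Omega>)"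
    using f g by (auto simp: Lp_def)
  have q1: "1 < q" "1 / p + 1 / q = 1"
    using p by (auto simp: q field_simps)
  have "norm (f x \<bullet> g x) \<le> norm (norm (f x) powr p / p + norm (g x) powr q / q)" for x
  proof -
    have "norm (f x \<bullet> g x) \<le> norm (f x) * norm (g x)"
      by (simp add: Cauchy_Schwarz_ineq2)
    also have "\<dots> \<le> norm (f x) powr p / p + norm (g x) powr q / q"
      using p q1 by (intro Youngs_inequality) auto
    finally show ?thesis
      by simp
  qed
  then show "AE x in lebesgue_on \<Omega>.
      norm (f x \<bullet> g x) \<le> norm (norm (f x) powr p / p + norm (g x) powr q / q)"
    by simp
qed

text \<open>The normal trace of \<open>y\<close> vanishes against functions in \<open>W1p\<close>
  with exponent \<open>q / (q - 1)\<close> and zero trace on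
  \<open>frontier \<Omega> - \<Gamma>\<^sub>N\<close>. That exponent is \<open>p\<close> and that
  set is \<open>\<Gamma>\<^sub>D\<close>, so \<open>v\<close> is an admissible test
  function.\<close>

lemma Green_zero_normal_trace:
  assumes boundary: "\<Gamma>\<^sub>D \<union> \<Gamma>\<^sub>N = frontier \<Omega>" "\<Gamma>\<^sub>D \<inter> \<Gamma>\<^sub>N = {}"
    and p: "1 < p" "q = p / (p - 1)"
    and v: "v \<in> W1p_D \<Omega> \<Gamma>\<^sub>D p" and y: "y \<in> W_N_div \<Omega> \<Gamma>\<^sub>N q"
  shows "(LINT x|lebesgue_on \<Omega>. weak_grad \<Omega> v x \<bullet> y x) =
         - (LINT x|lebesgue_on \<Omega>. v x * weak_div \<Omega> y x)"
proof -
  have "q - 1 = 1 / (p - 1)"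
    using p by (simp add: field_simps)
  then have "q / (q - 1) = p"
    using p by simp
  moreover have "frontier \<Omega> - \<Gamma>\<^sub>N = \<Gamma>\<^sub>D"
    using boundary by blast
  ultimately have "normal_trace \<Omega> y v = 0"
    using v y by (auto simp: W_N_div_def W1p_D_def)
  then show ?thesis
    by (simp add: normal_trace_def inner_commute mult.commute)
qed

text \<open>Cancellation for (i), with \<open>a\<close> = I(v), \<open>b\<close> = D(y) and
  \<open>c\<close> = I(u) = D(z). Only \<open>c\<close> has to be finite: I(v) = \<infinity> and
  D(y) = -\<infinity> are allowed and make both sides \<infinity>.\<close>

lemma ereal_add_diffs:
  fixes a b c :: ereal
  assumes "\<bar>c\<bar> \<noteq> \<infinity>" "a \<noteq> -\<infinity>" "b \<noteq> \<infinity>"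
  shows "(a - c) + (c - b) = a - b"
  using assms by (cases a; cases b; cases c) auto

theorem theorem3p1:
  fixes \<Omega> \<Gamma>\<^sub>D \<Gamma>\<^sub>N :: "(real ^ 'd) set"
    and p q :: real
    and \<phi> :: "real ^ 'd \<Rightarrow> ereal"
    and \<psi> :: "real ^ 'd \<Rightarrow> real \<Rightarrow> ereal"
    and u :: "real ^ 'd \<Rightarrow> real"
    and z :: "real ^ 'd \<Rightarrow> real ^ 'd"
  assumes domain: "polyhedral_lipschitz_domain \<Omega>"
    and boundary: "\<Gamma>\<^sub>D \<union> \<Gamma>\<^sub>N = frontier \<Omega>" "\<Gamma>\<^sub>D \<inter> \<Gamma>\<^sub>N = {}"
      "closed \<Gamma>\<^sub>D" "openin (top_of_set (frontier \<Omega>)) \<Gamma>\<^sub>N"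
    and exponents: "1 < p" "q = p / (p - 1)"
    and phi: "proper_on UNIV \<phi>" "convex_ereal \<phi>" "lsc \<phi>"
    and psi_measurable: "(\<lambda>(x, t). \<psi> x t) \<in> borel_measurable (lebesgue_on \<Omega> \<Otimes>\<^sub>M borel)"
    and psi_values: "\<forall>x\<in>\<Omega>. \<forall>t. \<psi> x t \<noteq> -\<infinity>"
    and psi: "AE x in lebesgue_on \<Omega>. proper_on UNIV (\<psi> x) \<and> convex_ereal (\<psi> x) \<and> lsc (\<psi> x)"
    and primal_well_defined:
      "\<forall>v\<in>W1p_D \<Omega> \<Gamma>\<^sub>D p. integral_well_defined (lebesgue_on \<Omega>) (\<lambda>x. \<phi> (weak_grad \<Omega> v x)) \<and>
                           integral_well_defined (lebesgue_on \<Omega>) (\<lambda>x. \<psi> x (v x))"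
    and dual_well_defined:
      "\<forall>y\<in>Lp \<Omega> q. integral_well_defined (lebesgue_on \<Omega>) (\<lambda>x. fenchel_conj \<phi> (y x))"
      "\<forall>y\<in>W_N_div \<Omega> \<Gamma>\<^sub>N q.
         integral_well_defined (lebesgue_on \<Omega>) (\<lambda>x. fenchel_conj (\<psi> x) (weak_div \<Omega> y x))"
    and dual_representation:
      "\<forall>y\<in>W_N_div \<Omega> \<Gamma>\<^sub>N q. dual_functional \<Omega> \<Gamma>\<^sub>D p \<phi> \<psi> y =
         - ereal_integral (lebesgue_on \<Omega>) (\<lambda>x. fenchel_conj \<phi> (y x))
         - ereal_integral (lebesgue_on \<Omega>) (\<lambda>x. fenchel_conj (\<psi> x) (weak_div \<Omega> y x))"
    and primal_proper: "proper_on (W1p_D \<Omega> \<Gamma>\<^sub>D p) (primal_functional \<Omega> \<phi> \<psi>)"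
    and dual_proper: "proper_on (Lp \<Omega> q) (\<lambda>y. - dual_functional \<Omega> \<Gamma>\<^sub>D p \<phi> \<psi> y)"
    and weak_duality: "(INF v\<in>W1p_D \<Omega> \<Gamma>\<^sub>D p. primal_functional \<Omega> \<phi> \<psi> v)
                       \<ge> (SUP y\<in>Lp \<Omega> q. dual_functional \<Omega> \<Gamma>\<^sub>D p \<phi> \<psi> y)"
    and u: "is_arg_min (primal_functional \<Omega> \<phi> \<psi>) (\<lambda>v. v \<in> W1p_D \<Omega> \<Gamma>\<^sub>D p) u"
    and z: "is_arg_max (dual_functional \<Omega> \<Gamma>\<^sub>D p \<phi> \<psi>) (\<lambda>y. y \<in> Lp \<Omega> q) z"
    and strong_duality: "primal_functional \<Omega> \<phi> \<psi> u = dual_functional \<Omega> \<Gamma>\<^sub>D p \<phi> \<psi> z"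
  shows "(\<forall>v\<in>W1p_D \<Omega> \<Gamma>\<^sub>D p. \<forall>y\<in>Lp \<Omega> q.
           rho2_primal \<Omega> \<phi> \<psi> v u + rho2_dual \<Omega> \<Gamma>\<^sub>D p \<phi> \<psi> y z = eta2 \<Omega> \<Gamma>\<^sub>D p \<phi> \<psi> v y) \<and>
         (\<forall>v\<in>W1p_D \<Omega> \<Gamma>\<^sub>D p. \<forall>y\<in>W_N_div \<Omega> \<Gamma>\<^sub>N q.
           eta2 \<Omega> \<Gamma>\<^sub>D p \<phi> \<psi> v y =
             ereal_integral (lebesgue_on \<Omega>)
               (\<lambda>x. \<phi> (weak_grad \<Omega> v x) - ereal (weak_grad \<Omega> v x \<bullet> y x) + fenchel_conj \<phi> (y x))
           + ereal_integral (lebesgue_on \<Omega>)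
               (\<lambda>x. \<psi> x (v x) - ereal (v x * weak_div \<Omega> y x) + fenchel_conj (\<psi> x) (weak_div \<Omega> y x)))"
proof (intro conjI ballI)
  let ?I = "primal_functional \<Omega> \<phi> \<psi>" and ?D = "dual_functional \<Omega> \<Gamma>\<^sub>D p \<phi> \<psi>"
  obtain v0 where v0: "v0 \<in> W1p_D \<Omega> \<Gamma>\<^sub>D p" "?I v0 \<noteq> \<infinity>"
    using primal_proper by (auto simp: proper_on_def)
  have "u \<in> W1p_D \<Omega> \<Gamma>\<^sub>D p" and "?I u \<le> ?I v0"
    using u v0 by (auto simp: is_arg_min_def not_less)
  \<comment> \<open>Minimality against \<open>v0\<close> bounds I(u) from above, and properness
    excludes -\<infinity>.\<close>
  then have Iu: "\<bar>?I u\<bar> \<noteq> \<infinity>"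
    using v0 primal_proper by (auto simp: proper_on_def)
  \<comment> \<open>This \<open>v\<close> serves both statements; the block below keeps the
    \<open>y\<close> of (i) apart from the more regular \<open>y\<close> of (ii).\<close>
  fix v assume v: "v \<in> W1p_D \<Omega> \<Gamma>\<^sub>D p"
  {
    fix y :: "real ^ 'd \<Rightarrow> real ^ 'd"
    assume y: "y \<in> Lp \<Omega> q"
    have "?I v \<noteq> -\<infinity>" "?D y \<noteq> \<infinity>"
      using primal_proper dual_proper v y by (auto simp: proper_on_def)
    then show "rho2_primal \<Omega> \<phi> \<psi> v u + rho2_dual \<Omega> \<Gamma>\<^sub>D p \<phi> \<psi> y z = eta2 \<Omega> \<Gamma>\<^sub>D p \<phi> \<psi> v y"
      using Iu unfolding rho2_primal_def rho2_dual_def eta2_def strong_duality[symmetric]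
      by (intro ereal_add_diffs)
  }
  fix y assume y: "y \<in> W_N_div \<Omega> \<Gamma>\<^sub>N q"
  let ?M = "lebesgue_on \<Omega>"
  have Lq: "y \<in> Lp \<Omega> q" "weak_div \<Omega> y \<in> Lp \<Omega> q"
    using y by (auto simp: W_N_div_def W_div_def)
  have Lp: "v \<in> Lp \<Omega> p" "weak_grad \<Omega> v \<in> Lp \<Omega> p"
    using v by (auto simp: W1p_D_def W1p_def)
  have wd: "integral_well_defined ?M (\<lambda>x. \<phi> (weak_grad \<Omega> v x))"
    "integral_well_defined ?M (\<lambda>x. \<psi> x (v x))"
    "integral_well_defined ?M (\<lambda>x. fenchel_conj \<phi> (y x))"
    "integral_well_defined ?M (\<lambda>x. fenchel_conj (\<psi> x) (weak_div \<Omega> y x))"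
    using primal_well_defined dual_well_defined v y Lq by auto
  have int: "integrable ?M (\<lambda>x. weak_grad \<Omega> v x \<bullet> y x)"
    "integrable ?M (\<lambda>x. v x * weak_div \<Omega> y x)"
    using integrable_inner_Lp[OF exponents Lp(2) Lq(1)] integrable_inner_Lp[OF exponents Lp(1) Lq(2)]
    by simp_all
  \<comment> \<open>Here \<open>r\<close> is the integral of
    \<open>v x * weak_div \<Omega> y x\<close>; by Green's formula the integral of the gradient term
    is \<open>- r\<close>, so the two inserted reals cancel. Since \<open>a\<close>,
    \<open>b\<close>, \<open>c\<close>, \<open>d\<close> avoid -\<infinity>, no difference of
    infinities arises.\<close>
  have rearrange: "a + b - (- c - d) = (a - ereal (- r) + c) + (b - ereal r + d)"
    if "a \<noteq> -\<infinity>" "b \<noteq> -\<infinity>" "c \<noteq> -\<infinity>" "d \<noteq> -\<infinity>" for a b c d :: ereal and r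
    using that by (cases a; cases b; cases c; cases d) auto
  show "eta2 \<Omega> \<Gamma>\<^sub>D p \<phi> \<psi> v y =
        ereal_integral ?M
          (\<lambda>x. \<phi> (weak_grad \<Omega> v x) - ereal (weak_grad \<Omega> v x \<bullet> y x) + fenchel_conj \<phi> (y x))
      + ereal_integral ?M
          (\<lambda>x. \<psi> x (v x) - ereal (v x * weak_div \<Omega> y x) + fenchel_conj (\<psi> x) (weak_div \<Omega> y x))"
    unfolding eta2_def dual_representation[rule_format, OF y] primal_functional_def
      F_functional_def
      ereal_integral_diff_add[OF wd(1) int(1) wd(3)] ereal_integral_diff_add[OF wd(2) int(2) wd(4)]
      Green_zero_normal_trace[OF boundary(1,2) exponents v y]
    by (intro rearrange wd[THEN ereal_integral_not_MInf])
qed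

end
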